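(* Let $X,Y$ be sets, let $a$ be a partial function from $Y$ to $X$, let $A=\operatorname{im}(a)$ and $\sigma=\ker(a)$, and let $\mathcal{PT}_{XY}^a=(\mathcal{PT}_{XY},\star_a)$, where $f\star_ag=fag$. Consider the map $$\psi:\operatorname{Reg}(\mathcal{PT}_{XY}^a)\to\operatorname{Reg}(\mathcal{PT}(X,A))\times\operatorname{Reg}(\mathcal{PT}(Y,\sigma)):f\mapsto(fa,af).$$ Then $\psi$ is injective, and $$\operatorname{im}(\psi)=\{(g,h)\in\operatorname{Reg}(\mathcal{PT}(X,A))\times\operatorname{Reg}(\mathcal{PT}(Y,\sigma)): ag=ha\}.$$ In particular, $\operatorname{Reg}(\mathcal{PT}_{XY}^a)$ is a pullback product of $\operatorname{Reg}(\mathcal{PT}(X,A))$ and $\operatorname{Reg}(\mathcal{PT}(Y,\sigma))$ with respect to $\mathcal{PT}_A$.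
   Context: Maps are written on the right and composed left to right. $\mathcal{PT}_{CD}$ is the set of all partial functions $C\to D$, and $\mathcal{PT}_C=\mathcal{PT}_{CC}$ is the partial transformation semigroup under composition. $\ker(a)=\{(x,y)\in\operatorname{dom}(a)\times\operatorname{dom}(a): xa=ya\}$, an equivalence on $\operatorname{dom}(a)\subseteq Y$. Define $$\mathcal{PT}(X,A)=\{f\in\mathcal{PT}_X:\operatorname{im}(f)\subseteq A\},\qquad \mathcal{PT}(Y,\sigma)=\{f\in\mathcal{PT}_Y:\text{every }\ker(f)\text{-class is a union of }\sigma\text{-classes}\},$$ which are semigroups under composition. For a semigroup $T$, $\operatorname{Reg}(T)=\{x\in T: x=xyx\text{ for some }y\in T\}$; for the three semigroups in the statement, $\operatorname{Reg}$ is a subsemigroup. A semigroup $S$ is a pullback product of semigroups $S_1,S_2$ with respect to a semigroup $T$ if there are surjective homomorphisms $\theta_1:S_1\to T$, $\theta_2:S_2\to T$ such that $S$ is isomorphic to the subsemigroup $\{(s_1,s_2)\in S_1\times S_2: s_1\theta_1=s_2\theta_2\}$ of $S_1\times S_2$. Here the isomorphism onto this subsemigroup is $\psi$, and the maps are as follows: for each $x\in A$ fix some $y_x\in Y$ with $y_xa=x$ and let $b\in\mathcal{PT}_{XY}$ be the partial map with domain $A$ and $xb=y_x$ (so $aba=a$, $bab=b$, and $ba$ is the partial identity on $A$); then $\theta_1:g\mapsto bag$ and $\theta_2:h\mapsto bha$, where $ba\,\mathcal{PT}_X\,ba=\{f\in\mathcal{PT}_X:\operatorname{dom}(f),\operatorname{im}(f)\subseteq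 A\}$ is identified with $\mathcal{PT}_A$. *)

theory Defs
  imports "HOL-Library.FuncSet"
begin

section \<open>Semigroups on a carrier set\<close>

record 'a sgrp =
  carr :: "'a set"
  mul :: "'a \<Rightarrow> 'a \<Rightarrow> 'a"

text \<open>The carrier may be empty; the values of \<^const>\<open>mul\<close> outside the carrier are irrelevant.\<close>

definition is_semigroup :: "'a sgrp \<Rightarrow> bool" where
  "is_semigroup S \<longleftrightarrow>
     (\<forall>x\<in>carr S. \<forall>y\<in>carr S. mul S x y \<in> carr S) \<and>
     (\<forall>x\<in>carr S. \<forall>y\<in>carr S. \<forall>z\<in>carr S. mul S (mul S x y) z = mul S x (mul S y z))"

definition sgrp_hom :: "'a sgrp \<Rightarrow> 'b sgrp \<Rightarrow> ('a \<Rightarrow> 'b) set" where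
  "sgrp_hom S T =
     {\<theta>. \<theta> \<in> carr S \<rightarrow> carr T \<and>
         (\<forall>x\<in>carr S. \<forall>y\<in>carr S. \<theta> (mul S x y) = mul T (\<theta> x) (\<theta> y))}"

definition sgrp_epi :: "'a sgrp \<Rightarrow> 'b sgrp \<Rightarrow> ('a \<Rightarrow> 'b) set" where
  "sgrp_epi S T = {\<theta> \<in> sgrp_hom S T. \<theta> ` carr S = carr T}"

definition sgrp_iso :: "'a sgrp \<Rightarrow> 'b sgrp \<Rightarrow> ('a \<Rightarrow> 'b) set" where
  "sgrp_iso S T = {\<theta> \<in> sgrp_hom S T. bij_betw \<theta> (carr S) (carr T)}"

definition sgrp_prod :: "'a sgrp \<Rightarrow> 'b sgrp \<Rightarrow> ('a \<times> 'b) sgrp" where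
  "sgrp_prod S T =
     \<lparr>carr = carr S \<times> carr T,
      mul = (\<lambda>p q. (mul S (fst p) (fst q), mul T (snd p) (snd q)))\<rparr>"

definition Reg :: "'a sgrp \<Rightarrow> 'a set" where
  "Reg S = {x \<in> carr S. \<exists>y\<in>carr S. x = mul S (mul S x y) x}"

text \<open>The regular elements with the multiplication of the ambient semigroup (in general not
  closed under it).\<close>

definition Reg_sgrp :: "'a sgrp \<Rightarrow> 'a sgrp" where
  "Reg_sgrp S = S\<lparr>carr := Reg S\<rparr>"

definition fibre_product ::
    "'a sgrp \<Rightarrow> 'b sgrp \<Rightarrow> ('a \<Rightarrow> 'c) \<Rightarrow> ('b \<Rightarrow> 'c) \<Rightarrow> ('a \<times> 'b) sgrp" where
  "fibre_product S1 S2 \<theta>1 \<theta>2 =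
     (sgrp_prod S1 S2)\<lparr>carr := {(s1, s2). s1 \<in> carr S1 \<and> s2 \<in> carr S2 \<and> \<theta>1 s1 = \<theta>2 s2}\<rparr>"

definition pullback_via ::
    "'s sgrp \<Rightarrow> 'a sgrp \<Rightarrow> 'b sgrp \<Rightarrow> 'c sgrp \<Rightarrow>
     ('a \<Rightarrow> 'c) \<Rightarrow> ('b \<Rightarrow> 'c) \<Rightarrow> ('s \<Rightarrow> 'a \<times> 'b) \<Rightarrow> bool" where
  "pullback_via S S1 S2 T \<theta>1 \<theta>2 \<phi> \<longleftrightarrow>
     is_semigroup S \<and> is_semigroup S1 \<and> is_semigroup S2 \<and> is_semigroup T \<and>
     \<theta>1 \<in> sgrp_epi S1 T \<and> \<theta>2 \<in> sgrp_epi S2 T \<and>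
     \<phi> \<in> sgrp_iso S (fibre_product S1 S2 \<theta>1 \<theta>2)"

definition pullback_product ::
    "'s sgrp \<Rightarrow> 'a sgrp \<Rightarrow> 'b sgrp \<Rightarrow> 'c sgrp \<Rightarrow> bool" where
  "pullback_product S S1 S2 T \<longleftrightarrow> (\<exists>\<theta>1 \<theta>2 \<phi>. pullback_via S S1 S2 T \<theta>1 \<theta>2 \<phi>)"


section \<open>Partial functions\<close>

text \<open>Maps act on the right and are composed left to right; partial functions between the sets
  \<open>C\<close> and \<open>D\<close> are maps that are undefined outside \<open>C\<close>, so that equality of partial functions is
  equality of maps, and the image of a partial function is its \<^const>\<open>ran\<close>.\<close>

abbreviation pcomp :: "('a \<rightharpoonup> 'b) \<Rightarrow> ('b \<rightharpoonup> 'c) \<Rightarrow> ('a \<rightharpoonup> 'c)" (infixl "\<Zsemi>" 70) where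
  "f \<Zsemi> g \<equiv> g \<circ>\<^sub>m f"

definition PT :: "'a set \<Rightarrow> 'b set \<Rightarrow> ('a \<rightharpoonup> 'b) set" where
  "PT C D = {f. dom f \<subseteq> C \<and> ran f \<subseteq> D}"

definition pker :: "('a \<rightharpoonup> 'b) \<Rightarrow> 'a rel" where
  "pker f = {(x, y) \<in> dom f \<times> dom f. f x = f y}"

definition PT_sgrp :: "'a set \<Rightarrow> ('a \<rightharpoonup> 'a) sgrp" where
  "PT_sgrp C = \<lparr>carr = PT C C, mul = (\<lambda>f g. f \<Zsemi> g)\<rparr>"

definition PT_im :: "'a set \<Rightarrow> 'a set \<Rightarrow> ('a \<rightharpoonup> 'a) sgrp" where
  "PT_im X A = \<lparr>carr = {f \<in> PT X X. ran f \<subseteq> A}, mul = (\<lambda>f g. f \<Zsemi> g)\<rparr>"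

text \<open>Here \<open>\<sigma>\<close> is an equivalence on a subset of \<open>Y\<close>, namely on \<^term>\<open>Domain \<sigma>\<close>, and
  \<^term>\<open>pker f\<close> is an equivalence on \<^term>\<open>dom f\<close>.\<close>

definition PT_ker :: "'a set \<Rightarrow> 'a rel \<Rightarrow> ('a \<rightharpoonup> 'a) sgrp" where
  "PT_ker Y \<sigma> =
     \<lparr>carr = {f \<in> PT Y Y. \<forall>K \<in> dom f // pker f. \<exists>\<C> \<subseteq> Domain \<sigma> // \<sigma>. K = \<Union>\<C>},
      mul = (\<lambda>f g. f \<Zsemi> g)\<rparr>"

definition sandwich :: "'a set \<Rightarrow> 'b set \<Rightarrow> ('b \<rightharpoonup> 'a) \<Rightarrow> ('a \<rightharpoonup> 'b) sgrp" where
  "sandwich X Y a = \<lparr>carr = PT X Y, mul = (\<lambda>f g. f \<Zsemi> a \<Zsemi> g)\<rparr>"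

definition psi :: "('b \<rightharpoonup> 'a) \<Rightarrow> ('a \<rightharpoonup> 'b) \<Rightarrow> ('a \<rightharpoonup> 'a) \<times> ('b \<rightharpoonup> 'b)" where
  "psi a f = (f \<Zsemi> a, a \<Zsemi> f)"

text \<open>The partial maps \<open>b\<close> that choose, for every \<open>x\<close> in the image of \<open>a\<close>, a preimage of \<open>x\<close>
  under \<open>a\<close>.\<close>

definition cross_sections :: "'b set \<Rightarrow> ('b \<rightharpoonup> 'a) \<Rightarrow> ('a \<rightharpoonup> 'b) set" where
  "cross_sections Y a =
     {b. dom b = ran a \<and> (\<forall>x \<in> ran a. \<exists>y\<in>Y. b x = Some y \<and> a y = Some x)}"

end

theory Submission
  imports Defs
begin

text \<open>
  Everything reduces to equations between words in the maps. With \<open>b\<close> a cross section of \<open>a\<close>,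
  the elements of \<open>PT_im X A\<close> are the \<open>g\<close> with \<open>g = gba\<close>, those of \<open>PT_ker Y \<sigma>\<close> are the \<open>h\<close>
  with \<open>h = abh\<close>. If \<open>ag = ha\<close> with \<open>g = gg'g\<close> and \<open>h = hh'h\<close>, the map \<open>f = gg'bh\<close> satisfies
  \<open>fa = gg'bag = gg'g = g\<close> and
  \<open>af = agg'bhh'h = agg'bhabh'h = agg'bagbh'h = agbh'h = habh'h = h\<close>,
  and it is regular because \<open>f = fa(g'b)af\<close>. That regular elements form subsemigroups comes from
  the von Neumann regularity of partial maps.
\<close>

section \<open>Partial maps\<close>

lemma pcomp_assoc: "(f \<Zsemi> g) \<Zsemi> h = f \<Zsemi> (g \<Zsemi> h)"
  by (auto simp: map_comp_def fun_eq_iff split: option.splits)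

text \<open>Simplification works on right-nested words, where a factor of three letters followed by
  a further letter is no longer a subterm. This form lets an equation for the factor fire there
  too.\<close>

lemma pcomp_extend: "f \<Zsemi> (g \<Zsemi> h) = k \<Longrightarrow> f \<Zsemi> (g \<Zsemi> (h \<Zsemi> z)) = k \<Zsemi> z"
  by (metis pcomp_assoc)

lemma dom_pcomp_subset: "dom (f \<Zsemi> g) \<subseteq> dom f"
  by (auto simp: map_comp_def split: option.splits)

lemma ran_pcomp_subset: "ran (f \<Zsemi> g) \<subseteq> ran g"
  by (auto simp: ran_def map_comp_Some_iff)

lemma pcomp_in_PT: "f \<in> PT C D \<Longrightarrow> g \<in> PT E F \<Longrightarrow> f \<Zsemi> g \<in> PT C F"
  using dom_pcomp_subset[of g f] ran_pcomp_subset[of g f] unfolding PT_def by blast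

text \<open>Choosing one preimage for each point of the image gives \<open>m\<close>: after
  \<open>f\<close>, passing through \<open>m\<close> and \<open>f\<close> again returns to the same
  value.\<close>

lemma PT_von_neumann_regular:
  assumes "f \<in> PT C D"
  obtains m where "m \<in> PT D C" "f \<Zsemi> (m \<Zsemi> f) = f"
proof
  let ?m = "\<lambda>y. if y \<in> ran f then Some (SOME x. f x = Some y) else None"
  have pick: "f (SOME z. f z = Some y) = Some y" if "f x = Some y" for x y
    using that by (rule someI)
  have "dom ?m \<subseteq> ran f"
    by (auto split: if_splits)
  moreover have "ran ?m \<subseteq> dom f"
  proof
    fix x assume "x \<in> ran ?m"
    then obtain y where y: "y \<in> ran f" "x = (SOME x. f x = Some y)"
      by (auto simp: ran_def split: if_splits)
    then obtain x' where "f x' = Some y"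
      by (auto simp: ran_def)
    then show "x \<in> dom f"
      using pick y(2) by blast
  qed
  ultimately show "?m \<in> PT D C"
    using assms unfolding PT_def by blast
  show "f \<Zsemi> (?m \<Zsemi> f) = f"
  proof
    fix x
    show "(f \<Zsemi> (?m \<Zsemi> f)) x = f x"
      by (cases "f x") (auto simp: map_comp_def pick ranI)
  qed
qed

lemma mul_simps:
  "mul (sandwich X Y a) f f' = f \<Zsemi> (a \<Zsemi> f')"
  "mul (PT_im X A) g g' = g \<Zsemi> g'"
  "mul (PT_ker Y \<sigma>) h h' = h \<Zsemi> h'"
  "mul (PT_sgrp C) k k' = k \<Zsemi> k'"
  by (simp_all add: sandwich_def PT_im_def PT_ker_def PT_sgrp_def pcomp_assoc)

lemma carr_PT_sgrp: "carr (PT_sgrp C) = PT C C"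
  by (simp add: PT_sgrp_def)

lemma carr_sandwich: "carr (sandwich X Y a) = PT X Y"
  by (simp add: sandwich_def)

text \<open>A union of \<open>pker a\<close>-classes contains, with each point, the whole class of
  that point. The equation \<open>f x = f y\<close> compares options, so it also makes
  \<open>dom f\<close> saturated.\<close>

lemma pker_class_unions_iff:
  "(\<forall>K \<in> dom f // pker f. \<exists>\<C> \<subseteq> Domain (pker a) // pker a. K = \<Union>\<C>) \<longleftrightarrow>
   dom f \<subseteq> dom a \<and> (\<forall>(x, y) \<in> pker a. f x = f y)" (is "?L \<longleftrightarrow> ?R")
proof
  assume L: ?L
  have saturated: "x \<in> dom a \<and> (\<forall>y. (x, y) \<in> pker a \<longrightarrow> f x = f y)" if x: "x \<in> dom f" for x
  proof -
    have "pker f `` {x} \<in> dom f // pker f"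
      using x by (rule quotientI)
    with L obtain \<C> where \<C>: "\<C> \<subseteq> Domain (pker a) // pker a" "pker f `` {x} = \<Union>\<C>"
      by blast
    have "x \<in> pker f `` {x}"
      using x by (simp add: pker_def)
    with \<C>(2) obtain C where C: "C \<in> \<C>" "x \<in> C"
      by blast
    from C(1) \<C>(1) obtain z where z: "C = pker a `` {z}"
      by (meson quotientE subsetD)
    have "x \<in> dom a"
      using C(2) by (auto simp: z pker_def)
    moreover have "f x = f y" if "(x, y) \<in> pker a" for y
    proof -
      have "y \<in> C"
        using C(2) that by (auto simp: z pker_def)
      then have "y \<in> pker f `` {x}"
        using C(1) \<C>(2) by blast
      then show ?thesis
        by (simp add: pker_def)
    qed
    ultimately show ?thesis by blast
  qed
  have "f x = f y" if xy: "(x, y) \<in> pker a" for x y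
  \<comment> \<open>Saturation applies as soon as one of the points lies in \<open>dom f\<close>, up
    to symmetry; otherwise both values are \<open>None\<close>.\<close>
  proof (cases "x \<in> dom f \<or> y \<in> dom f")
    case True
    moreover have "(y, x) \<in> pker a"
      using xy by (simp add: pker_def)
    ultimately show ?thesis
      using saturated xy by metis
  next
    case False
    then show ?thesis by (simp add: domIff)
  qed
  then show ?R
    using saturated by blast
next
  assume R: ?R
  show ?L
  proof
    fix K assume "K \<in> dom f // pker f"
    then obtain x where x: "x \<in> dom f" "K = pker f `` {x}"
      by (rule quotientE)
    \<comment> \<open>The class \<open>K\<close> is the union of the \<open>pker a\<close>-classes
      of its own points.\<close>
    let ?\<C> = "(\<lambda>y. pker a `` {y}) ` K"
    have K_dom: "K \<subseteq> Domain (pker a)"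
    proof
      fix y assume "y \<in> K"
      then have "y \<in> dom f"
        by (simp add: x(2) pker_def)
      then have "(y, y) \<in> pker a"
        using R by (auto simp: pker_def)
      then show "y \<in> Domain (pker a)" ..
    qed
    then have "?\<C> \<subseteq> Domain (pker a) // pker a"
      by (auto intro: quotientI)
    moreover have "K = \<Union>?\<C>"
    proof
      show "K \<subseteq> \<Union>?\<C>"
        using K_dom by (auto simp: pker_def)
      show "\<Union>?\<C> \<subseteq> K"
      proof
        fix z assume "z \<in> \<Union>?\<C>"
        then obtain y where "y \<in> K" and yz: "(y, z) \<in> pker a"
          by blast
        moreover have "f y = f z"
          using R yz by blast
        ultimately show "z \<in> K"
          using x by (auto simp: pker_def)
      qed
    qed
    ultimately show "\<exists>\<C> \<subseteq> Domain (pker a) // pker a. K = \<Union>\<C>"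
      by blast
  qed
qed

text \<open>By choice. This lets the claims about \<open>psi\<close> that mention no cross section
  be proved with the help of one.\<close>

lemma cross_sections_nonempty:
  assumes "a \<in> PT Y X"
  shows "cross_sections Y a \<noteq> {}"
proof -
  let ?b = "\<lambda>x. if x \<in> ran a then Some (SOME y. a y = Some x) else None"
  have "a (SOME y. a y = Some x) = Some x" if "x \<in> ran a" for x
    using that by (auto simp: ran_def intro: someI)
  moreover have "y \<in> Y" if "a y = Some x" for x y
    using assms that by (auto simp: PT_def)
  ultimately have "?b \<in> cross_sections Y a"
    by (auto simp: cross_sections_def dom_def)
  then show ?thesis by blast
qed

section \<open>A sandwich element with a cross section\<close>

locale sandwich_section =
  fixes X :: "'x set" and Y :: "'y set" and a :: "'y \<rightharpoonup> 'x" and b :: "'x \<rightharpoonup> 'y"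
  assumes a_in: "a \<in> PT Y X" and b_section: "b \<in> cross_sections Y a"
begin

lemma b_Some: "x \<in> ran a \<Longrightarrow> \<exists>y. b x = Some y \<and> a y = Some x"
  and b_None: "x \<notin> ran a \<Longrightarrow> b x = None"
  using b_section by (auto simp: cross_sections_def)

lemma b_in: "b \<in> PT X Y"
proof -
  have "ran b \<subseteq> Y"
  proof
    fix y assume "y \<in> ran b"
    then obtain x where x: "b x = Some y"
      by (auto simp: ran_def)
    then have "x \<in> ran a"
      using b_None by force
    then show "y \<in> Y"
      using b_section x by (auto simp: cross_sections_def)
  qed
  then show ?thesis
    using a_in b_section by (simp add: PT_def cross_sections_def)
qed

lemma ba_apply: "(b \<Zsemi> a) x = (if x \<in> ran a then Some x else None)"
  using b_Some[of x] b_None[of x] by (auto simp: map_comp_def)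

text \<open>Since \<open>ba\<close> is the partial identity on \<open>ran a\<close>, multiplying by
  it on the right deletes exactly the values outside \<open>ran a\<close>.\<close>

lemma pcomp_ba_iff: "g \<Zsemi> (b \<Zsemi> a) = g \<longleftrightarrow> ran g \<subseteq> ran a"
proof
  assume "g \<Zsemi> (b \<Zsemi> a) = g"
  then show "ran g \<subseteq> ran a"
    by (metis ran_pcomp_subset order_trans)
next
  assume g: "ran g \<subseteq> ran a"
  show "g \<Zsemi> (b \<Zsemi> a) = g"
  proof
    fix x
    show "(g \<Zsemi> (b \<Zsemi> a)) x = g x"
    proof (cases "g x")
      case (Some y)
      then have "y \<in> ran a"
        using g by (auto simp: ran_def)
      with Some show ?thesis
        by (simp add: ba_apply)
    qed simp
  qed
qed

lemma ba_pcomp: "dom f \<subseteq> ran a \<Longrightarrow> b \<Zsemi> (a \<Zsemi> f) = f"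
  unfolding pcomp_assoc[symmetric]
proof
  fix x assume f: "dom f \<subseteq> ran a"
  show "((b \<Zsemi> a) \<Zsemi> f) x = f x"
  proof (cases "x \<in> ran a")
    case True
    then show ?thesis by (simp add: ba_apply)
  next
    case False
    then have "f x = None"
      using f by blast
    with False show ?thesis by (simp add: ba_apply)
  qed
qed

lemma aba: "a \<Zsemi> (b \<Zsemi> a) = a"
  by (simp add: pcomp_ba_iff)

lemma bab: "b \<Zsemi> (a \<Zsemi> b) = b"
  using b_None by (intro ba_pcomp) force

lemmas aba_simps = pcomp_assoc aba bab pcomp_extend[OF aba] pcomp_extend[OF bab]

text \<open>The map \<open>ab\<close> sends a point of \<open>dom a\<close> to the chosen
  representative of its kernel class and is undefined elsewhere. Together with
  \<open>pker_class_unions_iff\<close> this turns the kernel condition into an equation between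
  words.\<close>

lemma ab_pcomp_iff:
  "a \<Zsemi> (b \<Zsemi> h) = h \<longleftrightarrow> dom h \<subseteq> dom a \<and> (\<forall>(x, y) \<in> pker a. h x = h y)" (is "?L \<longleftrightarrow> ?R")
proof
  assume h: ?L
  \<comment> \<open>The equation makes \<open>h\<close> factor through \<open>a\<close>; both
    conditions are read off from this.\<close>
  have val: "h x = (case a x of None \<Rightarrow> None | Some z \<Rightarrow> (b \<Zsemi> h) z)" for x
    using fun_cong[OF h, of x] by (cases "a x") simp_all
  show ?R
  proof (intro conjI subsetI)
    fix x assume "x \<in> dom h"
    then show "x \<in> dom a"
      using val[of x] by (auto split: option.splits)
  next
    show "\<forall>(x, y) \<in> pker a. h x = h y"
      using val by (auto simp: pker_def)
  qed
next
  assume R: ?R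
  show ?L
  proof
    fix x
    show "(a \<Zsemi> (b \<Zsemi> h)) x = h x"
    proof (cases "a x")
      case None
      then have "h x = None"
        using R by blast
      with None show ?thesis by simp
    next
      case (Some z)
      \<comment> \<open>The point \<open>y\<close> is the representative that \<open>b\<close> picks
        for the class of \<open>x\<close>, so \<open>h y = h x\<close>.\<close>
      then obtain y where y: "b z = Some y" "a y = Some z"
        using b_Some ranI by metis
      then have "(y, x) \<in> pker a"
        using Some by (auto simp: pker_def)
      with R y Some show ?thesis
        by auto
    qed
  qed
qed

section \<open>Carriers and regular elements in terms of equations\<close>

lemma carr_PT_im: "carr (PT_im X (ran a)) = {g \<in> PT X X. g \<Zsemi> (b \<Zsemi> a) = g}"
  by (simp add: PT_im_def pcomp_ba_iff)

lemma carr_PT_ker: "carr (PT_ker Y (pker a)) = {h \<in> PT Y Y. a \<Zsemi> (b \<Zsemi> h) = h}"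
  by (simp add: PT_ker_def pker_class_unions_iff ab_pcomp_iff)

lemma Reg_PT_im_iff:
  "g \<in> Reg (PT_im X (ran a)) \<longleftrightarrow> g \<in> PT X X \<and> g \<Zsemi> (b \<Zsemi> a) = g \<and>
     (\<exists>u \<in> PT X X. u \<Zsemi> (b \<Zsemi> a) = u \<and> g \<Zsemi> (u \<Zsemi> g) = g)"
  unfolding Reg_def carr_PT_im by (auto simp: mul_simps pcomp_assoc)

lemma Reg_PT_ker_iff:
  "h \<in> Reg (PT_ker Y (pker a)) \<longleftrightarrow> h \<in> PT Y Y \<and> a \<Zsemi> (b \<Zsemi> h) = h \<and>
     (\<exists>u \<in> PT Y Y. a \<Zsemi> (b \<Zsemi> u) = u \<and> h \<Zsemi> (u \<Zsemi> h) = h)"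
  unfolding Reg_def carr_PT_ker by (auto simp: mul_simps pcomp_assoc)

lemma Reg_sandwich_iff:
  "f \<in> Reg (sandwich X Y a) \<longleftrightarrow> f \<in> PT X Y \<and>
     (\<exists>u \<in> PT X Y. f \<Zsemi> (a \<Zsemi> (u \<Zsemi> (a \<Zsemi> f))) = f)"
  unfolding Reg_def by (simp add: mul_simps carr_sandwich pcomp_assoc eq_commute[of f])

lemma Reg_PT_imI:
  assumes "g \<in> PT X X" "g \<Zsemi> (b \<Zsemi> a) = g" "u \<in> PT X X" "u \<Zsemi> (b \<Zsemi> a) = u"
    and "g \<Zsemi> (u \<Zsemi> g) = g"
  shows "g \<in> Reg (PT_im X (ran a))"
  unfolding Reg_PT_im_iff using assms by blast

lemma Reg_PT_kerI:
  assumes "h \<in> PT Y Y" "a \<Zsemi> (b \<Zsemi> h) = h" "u \<in> PT Y Y" "a \<Zsemi> (b \<Zsemi> u) = u"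
    and "h \<Zsemi> (u \<Zsemi> h) = h"
  shows "h \<in> Reg (PT_ker Y (pker a))"
  unfolding Reg_PT_ker_iff using assms by blast

lemma Reg_sandwichI:
  assumes "f \<in> PT X Y" "u \<in> PT X Y" "f \<Zsemi> (a \<Zsemi> (u \<Zsemi> (a \<Zsemi> f))) = f"
  shows "f \<in> Reg (sandwich X Y a)"
  unfolding Reg_sandwich_iff using assms by blast

section \<open>Closure of the regular elements under multiplication\<close>

lemmas PT_closed = pcomp_in_PT a_in b_in

lemma Reg_PT_im_mult:
  assumes "g \<in> Reg (PT_im X (ran a))" "h \<in> Reg (PT_im X (ran a))"
  shows "g \<Zsemi> h \<in> Reg (PT_im X (ran a))"
proof -
  from assms obtain u where u: "u \<in> PT X X" "u \<Zsemi> (b \<Zsemi> a) = u" "g \<Zsemi> (u \<Zsemi> g) = g"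
    and g: "g \<in> PT X X" and h: "h \<in> PT X X" "h \<Zsemi> (b \<Zsemi> a) = h"
    unfolding Reg_PT_im_iff by blast
  \<comment> \<open>The inverse is taken for \<open>bagh\<close> instead of \<open>gh\<close>, so
    that \<open>m\<close> can be multiplied by \<open>ba\<close> to bring its image into
    \<open>ran a\<close>.\<close>
  obtain m where m: "m \<in> PT X X"
    "(b \<Zsemi> a \<Zsemi> g \<Zsemi> h) \<Zsemi> (m \<Zsemi> (b \<Zsemi> a \<Zsemi> g \<Zsemi> h)) = b \<Zsemi> a \<Zsemi> g \<Zsemi> h"
    by (rule PT_von_neumann_regular[of "b \<Zsemi> a \<Zsemi> g \<Zsemi> h" X X]) (use g h in \<open>auto intro: PT_closed\<close>)
  have "(g \<Zsemi> h) \<Zsemi> ((m \<Zsemi> (b \<Zsemi> a)) \<Zsemi> (g \<Zsemi> h)) = g \<Zsemi> h"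
    \<comment> \<open>From \<open>uba = u\<close> and \<open>gug = g\<close> the left factor
      \<open>gu\<close> turns \<open>bagh\<close> into \<open>gh\<close>.\<close>
    using arg_cong[OF m(2), of "\<lambda>z. g \<Zsemi> u \<Zsemi> z"]
    by (simp add: pcomp_assoc pcomp_extend[OF u(2)] pcomp_extend[OF u(3)])
  moreover have "m \<Zsemi> (b \<Zsemi> a) \<in> PT X X" "(m \<Zsemi> (b \<Zsemi> a)) \<Zsemi> (b \<Zsemi> a) = m \<Zsemi> (b \<Zsemi> a)"
    using m(1) by (auto intro: PT_closed simp: aba_simps)
  moreover have "g \<Zsemi> h \<in> PT X X" "(g \<Zsemi> h) \<Zsemi> (b \<Zsemi> a) = g \<Zsemi> h"
    using g h by (auto intro: PT_closed simp: pcomp_assoc)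
  ultimately show ?thesis
    by (intro Reg_PT_imI)
qed

text \<open>Mirror image of \<open>Reg_PT_im_mult\<close>: \<open>m\<close> inverts
  \<open>hkab\<close>, the inverse of \<open>hk\<close> is \<open>abm\<close>, and the right factor
  \<open>vk\<close> turns \<open>hkab\<close> into \<open>hkvk = hk\<close>.\<close>

lemma Reg_PT_ker_mult:
  assumes "h \<in> Reg (PT_ker Y (pker a))" "k \<in> Reg (PT_ker Y (pker a))"
  shows "h \<Zsemi> k \<in> Reg (PT_ker Y (pker a))"
proof -
  from assms obtain v where v: "v \<in> PT Y Y" "a \<Zsemi> (b \<Zsemi> v) = v" "k \<Zsemi> (v \<Zsemi> k) = k"
    and k: "k \<in> PT Y Y" and h: "h \<in> PT Y Y" "a \<Zsemi> (b \<Zsemi> h) = h"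
    unfolding Reg_PT_ker_iff by blast
  obtain m where m: "m \<in> PT Y Y"
    "(h \<Zsemi> k \<Zsemi> a \<Zsemi> b) \<Zsemi> (m \<Zsemi> (h \<Zsemi> k \<Zsemi> a \<Zsemi> b)) = h \<Zsemi> k \<Zsemi> a \<Zsemi> b"
    by (rule PT_von_neumann_regular[of "h \<Zsemi> k \<Zsemi> a \<Zsemi> b" Y Y]) (use h k in \<open>auto intro: PT_closed\<close>)
  have "(h \<Zsemi> k) \<Zsemi> ((a \<Zsemi> (b \<Zsemi> m)) \<Zsemi> (h \<Zsemi> k)) = h \<Zsemi> k"
    using arg_cong[OF m(2), of "\<lambda>z. z \<Zsemi> (v \<Zsemi> k)"]
    by (simp add: pcomp_assoc pcomp_extend[OF v(2)] v(3))
  moreover have "a \<Zsemi> (b \<Zsemi> m) \<in> PT Y Y" "a \<Zsemi> (b \<Zsemi> (a \<Zsemi> (b \<Zsemi> m))) = a \<Zsemi> (b \<Zsemi> m)"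
    using m(1) by (auto intro: PT_closed simp: aba_simps)
  moreover have "h \<Zsemi> k \<in> PT Y Y" "a \<Zsemi> (b \<Zsemi> (h \<Zsemi> k)) = h \<Zsemi> k"
    using h k by (auto intro: PT_closed simp: pcomp_assoc pcomp_extend[OF h(2)])
  ultimately show ?thesis
    by (intro Reg_PT_kerI)
qed

text \<open>An inverse \<open>m\<close> of \<open>w = afaga\<close> also serves the sandwich
  product, because \<open>fag = (fau)w(vag)\<close> by regularity of \<open>f\<close> and
  \<open>g\<close>.\<close>

lemma Reg_sandwich_mult:
  assumes "f \<in> Reg (sandwich X Y a)" "g \<in> Reg (sandwich X Y a)"
  shows "f \<Zsemi> (a \<Zsemi> g) \<in> Reg (sandwich X Y a)"
proof -
  from assms obtain u v where u: "f \<Zsemi> (a \<Zsemi> (u \<Zsemi> (a \<Zsemi> f))) = f" and v: "g \<Zsemi> (a \<Zsemi> (v \<Zsemi> (a \<Zsemi> g))) = g"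
    and f: "f \<in> PT X Y" and g: "g \<in> PT X Y"
    unfolding Reg_sandwich_iff by blast
  let ?w = "a \<Zsemi> f \<Zsemi> a \<Zsemi> g \<Zsemi> a"
  have "?w \<in> PT Y X"
    by (rule pcomp_in_PT[OF pcomp_in_PT[OF pcomp_in_PT[OF pcomp_in_PT[OF a_in f] a_in] g] a_in])
  then obtain m where m: "m \<in> PT X Y" "?w \<Zsemi> (m \<Zsemi> ?w) = ?w"
    by (rule PT_von_neumann_regular)
  have u': "f \<Zsemi> (a \<Zsemi> (u \<Zsemi> (a \<Zsemi> (f \<Zsemi> z)))) = f \<Zsemi> z" for z
    using arg_cong[OF u, of "\<lambda>x. x \<Zsemi> z"] by (simp add: pcomp_assoc)
  have "(f \<Zsemi> (a \<Zsemi> g)) \<Zsemi> (a \<Zsemi> (m \<Zsemi> (a \<Zsemi> (f \<Zsemi> (a \<Zsemi> g))))) = f \<Zsemi> (a \<Zsemi> g)"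
    using arg_cong[OF m(2), of "\<lambda>z. f \<Zsemi> a \<Zsemi> u \<Zsemi> z \<Zsemi> v \<Zsemi> a \<Zsemi> g"]
    by (simp add: pcomp_assoc u' v)
  moreover have "f \<Zsemi> (a \<Zsemi> g) \<in> PT X Y"
    by (rule pcomp_in_PT[OF f pcomp_in_PT[OF a_in g]])
  ultimately show ?thesis
    using m(1) by (intro Reg_sandwichI)
qed

lemma is_semigroup_Reg:
  shows "is_semigroup (Reg_sgrp (sandwich X Y a))"
    and "is_semigroup (Reg_sgrp (PT_im X (ran a)))"
    and "is_semigroup (Reg_sgrp (PT_ker Y (pker a)))"
  unfolding is_semigroup_def Reg_sgrp_def
  by (simp_all add: mul_simps Reg_sandwich_mult Reg_PT_im_mult Reg_PT_ker_mult pcomp_assoc)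

lemma is_semigroup_PT: "is_semigroup (PT_sgrp C)"
  by (auto simp: is_semigroup_def PT_sgrp_def pcomp_assoc intro: pcomp_in_PT)

section \<open>The map \<open>psi\<close>: codomain, injectivity and image\<close>

lemma psi_in_Reg:
  assumes "f \<in> Reg (sandwich X Y a)"
  shows "f \<Zsemi> a \<in> Reg (PT_im X (ran a))" "a \<Zsemi> f \<in> Reg (PT_ker Y (pker a))"
proof -
  from assms obtain u where f: "f \<in> PT X Y" and u: "u \<in> PT X Y" "f \<Zsemi> (a \<Zsemi> (u \<Zsemi> (a \<Zsemi> f))) = f"
    unfolding Reg_sandwich_iff by blast
  \<comment> \<open>Multiplying \<open>fauaf = f\<close> by \<open>a\<close> shows that
    \<open>ua\<close> inverts \<open>fa\<close>; read as it stands under \<open>a\<close> on the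
    left, it shows that \<open>au\<close> inverts \<open>af\<close>.\<close>
  have "(f \<Zsemi> a) \<Zsemi> ((u \<Zsemi> a) \<Zsemi> (f \<Zsemi> a)) = f \<Zsemi> a"
    using arg_cong[OF u(2), of "\<lambda>x. x \<Zsemi> a"] by (simp add: pcomp_assoc)
  moreover have "f \<Zsemi> a \<in> PT X X" "u \<Zsemi> a \<in> PT X X"
    using f u(1) by (auto intro: PT_closed)
  ultimately show "f \<Zsemi> a \<in> Reg (PT_im X (ran a))"
    by (intro Reg_PT_imI[where u = "u \<Zsemi> a"]) (simp_all add: aba_simps)
  have "(a \<Zsemi> f) \<Zsemi> ((a \<Zsemi> u) \<Zsemi> (a \<Zsemi> f)) = a \<Zsemi> f"
    using u(2) by (simp add: pcomp_assoc)
  moreover have "a \<Zsemi> f \<in> PT Y Y" "a \<Zsemi> u \<in> PT Y Y"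
    using f u(1) by (auto intro: PT_closed)
  ultimately show "a \<Zsemi> f \<in> Reg (PT_ker Y (pker a))"
    by (intro Reg_PT_kerI[where u = "a \<Zsemi> u"]) (simp_all add: aba_simps)
qed

text \<open>Regularity recovers an element from its two images:
  \<open>g = gavag = (fa)vag = fau(af)avag = fau(gavag)\<close> with \<open>a\<close> in front of
  the bracket, that is \<open>fauag = fauaf = f\<close>.\<close>

lemma psi_inj: "inj_on (psi a) (Reg (sandwich X Y a))"
proof (rule inj_onI)
  fix f g
  assume "f \<in> Reg (sandwich X Y a)" "g \<in> Reg (sandwich X Y a)" "psi a f = psi a g"
  then obtain u v where u: "f \<Zsemi> (a \<Zsemi> (u \<Zsemi> (a \<Zsemi> f))) = f" and v: "g \<Zsemi> (a \<Zsemi> (v \<Zsemi> (a \<Zsemi> g))) = g"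
    and fa: "f \<Zsemi> a = g \<Zsemi> a" and af: "a \<Zsemi> f = a \<Zsemi> g"
    unfolding Reg_sandwich_iff psi_def by blast
  have "g = (f \<Zsemi> a) \<Zsemi> (v \<Zsemi> (a \<Zsemi> g))"
    unfolding fa by (simp add: pcomp_assoc v)
  also have "f \<Zsemi> a = (f \<Zsemi> (a \<Zsemi> (u \<Zsemi> (a \<Zsemi> f)))) \<Zsemi> a"
    by (simp add: u)
  also have "\<dots> \<Zsemi> (v \<Zsemi> (a \<Zsemi> g)) = f \<Zsemi> (a \<Zsemi> (u \<Zsemi> (a \<Zsemi> g)))"
    unfolding af by (simp add: pcomp_assoc v)
  also have "\<dots> = f"
    unfolding af[symmetric] by (rule u)
  finally show "f = g" by simp
qed

lemma psi_image:
  "psi a ` Reg (sandwich X Y a) =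
     {(g, h) \<in> Reg (PT_im X (ran a)) \<times> Reg (PT_ker Y (pker a)). a \<Zsemi> g = h \<Zsemi> a}"
proof (intro set_eqI iffI)
  fix p assume "p \<in> psi a ` Reg (sandwich X Y a)"
  then show "p \<in> {(g, h) \<in> Reg (PT_im X (ran a)) \<times> Reg (PT_ker Y (pker a)). a \<Zsemi> g = h \<Zsemi> a}"
    using psi_in_Reg by (auto simp: psi_def pcomp_assoc)
next
  fix p assume "p \<in> {(g, h) \<in> Reg (PT_im X (ran a)) \<times> Reg (PT_ker Y (pker a)). a \<Zsemi> g = h \<Zsemi> a}"
  then obtain g h where p: "p = (g, h)" and ag: "a \<Zsemi> g = h \<Zsemi> a"
    and "g \<in> Reg (PT_im X (ran a))" "h \<in> Reg (PT_ker Y (pker a))"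
    by blast
  then obtain g' h' where g: "g \<in> PT X X" "g' \<in> PT X X" "g' \<Zsemi> (b \<Zsemi> a) = g'" "g \<Zsemi> (g' \<Zsemi> g) = g"
    and h: "h \<in> PT Y Y" "a \<Zsemi> (b \<Zsemi> h') = h'" "h \<Zsemi> (h' \<Zsemi> h) = h"
    unfolding Reg_PT_im_iff Reg_PT_ker_iff by blast
  define f where "f = g \<Zsemi> (g' \<Zsemi> (b \<Zsemi> h))"
  have fa: "f \<Zsemi> a = g"
    by (simp add: f_def pcomp_assoc ag[symmetric] pcomp_extend[OF g(3)] g(4))
  \<comment> \<open>Writing the last factor \<open>h\<close> as \<open>hh'h\<close> with
    \<open>h' = abh'\<close> exposes \<open>ha\<close>, which can be exchanged for
    \<open>ag\<close>.\<close>
  have "a \<Zsemi> f = a \<Zsemi> (g \<Zsemi> (g' \<Zsemi> (b \<Zsemi> ((h \<Zsemi> a) \<Zsemi> (b \<Zsemi> (h' \<Zsemi> h))))))"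
    by (simp add: f_def pcomp_assoc pcomp_extend[OF h(2)] h(3))
  \<comment> \<open>After the exchange \<open>gg'bag\<close> appears, and it collapses to
    \<open>gg'g = g\<close>.\<close>
  also have "\<dots> = (a \<Zsemi> g) \<Zsemi> (b \<Zsemi> (h' \<Zsemi> h))"
    unfolding ag[symmetric]
    by (simp add: pcomp_assoc pcomp_extend[OF g(3)] pcomp_extend[OF g(4)])
  also have "\<dots> = h"
    unfolding ag by (simp add: pcomp_assoc pcomp_extend[OF h(2)] h(3))
  finally have af: "a \<Zsemi> f = h" .
  have "f \<Zsemi> (a \<Zsemi> ((g' \<Zsemi> b) \<Zsemi> (a \<Zsemi> f))) = (f \<Zsemi> a) \<Zsemi> (g' \<Zsemi> (b \<Zsemi> (a \<Zsemi> f)))"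
    by (simp add: pcomp_assoc)
  also have "\<dots> = f"
    unfolding fa af by (simp add: f_def)
  finally have "f \<Zsemi> (a \<Zsemi> ((g' \<Zsemi> b) \<Zsemi> (a \<Zsemi> f))) = f" .
  moreover have "f \<in> PT X Y" "g' \<Zsemi> b \<in> PT X Y"
    unfolding f_def using g(1,2) h(1) by (auto intro: PT_closed)
  ultimately have "f \<in> Reg (sandwich X Y a)"
    by (intro Reg_sandwichI)
  then show "p \<in> psi a ` Reg (sandwich X Y a)"
    using fa af by (force simp: p psi_def)
qed

section \<open>The epimorphisms onto the partial transformations of \<open>ran a\<close>, and the
  pullback\<close>

lemma PT_ran_iff:
  "f \<in> PT (ran a) (ran a) \<longleftrightarrow> f \<in> PT X X \<and> b \<Zsemi> (a \<Zsemi> f) = f \<and> f \<Zsemi> (b \<Zsemi> a) = f"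
proof -
  \<comment> \<open>The map \<open>ba\<close> is undefined off \<open>ran a\<close>, so a map that
    it fixes from the left has its domain there. This half identifies the local monoid of
    \<open>ba\<close> with \<open>PT (ran a) (ran a)\<close>.\<close>
  have "dom f \<subseteq> ran a" if "b \<Zsemi> (a \<Zsemi> f) = f"
  proof
    fix x assume "x \<in> dom f"
    then have "((b \<Zsemi> a) \<Zsemi> f) x \<noteq> None"
      using that by (simp add: pcomp_assoc domIff)
    then show "x \<in> ran a"
      using ba_apply[of x] by (cases "x \<in> ran a") (auto simp: map_comp_def)
  qed
  then show ?thesis
    using a_in ba_pcomp[of f] by (auto simp: PT_def pcomp_ba_iff)
qed

text \<open>The \<open>ba\<close> inserted between two factors is absorbed by the first, as
  \<open>gba = g\<close>. For surjectivity, each \<open>f\<close> in the target is regular with an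
  inverse in the target, and is its own preimage because \<open>baf = f\<close>.\<close>

lemma theta1_epi:
  "(\<lambda>g. b \<Zsemi> a \<Zsemi> g) \<in> sgrp_epi (Reg_sgrp (PT_im X (ran a))) (PT_sgrp (ran a))"
proof -
  have into: "b \<Zsemi> a \<Zsemi> g \<in> PT (ran a) (ran a)" if "g \<in> Reg (PT_im X (ran a))" for g
    using that unfolding PT_ran_iff Reg_PT_im_iff
    by (auto intro: PT_closed simp: aba_simps)
  have hom: "b \<Zsemi> a \<Zsemi> (g \<Zsemi> h) = (b \<Zsemi> a \<Zsemi> g) \<Zsemi> (b \<Zsemi> a \<Zsemi> h)"
    if "g \<in> Reg (PT_im X (ran a))" for g h :: "'x \<rightharpoonup> 'x"
  proof -
    have gba: "g \<Zsemi> (b \<Zsemi> a) = g"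
      using that unfolding Reg_PT_im_iff by blast
    show ?thesis
      by (simp add: pcomp_assoc pcomp_extend[OF gba])
  qed
  have onto: "\<exists>g \<in> Reg (PT_im X (ran a)). f = b \<Zsemi> a \<Zsemi> g" if f: "f \<in> PT (ran a) (ran a)" for f
  proof -
    obtain m where "m \<in> PT (ran a) (ran a)" "f \<Zsemi> (m \<Zsemi> f) = f"
      using PT_von_neumann_regular[OF f] by blast
    with f have "f \<in> Reg (PT_im X (ran a))" "f = b \<Zsemi> a \<Zsemi> f"
      unfolding PT_ran_iff Reg_PT_im_iff by (auto simp: pcomp_assoc)
    then show ?thesis by blast
  qed
  have "(\<lambda>g. b \<Zsemi> a \<Zsemi> g) ` Reg (PT_im X (ran a)) = PT (ran a) (ran a)"
    unfolding image_def using into onto by blast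
  then show ?thesis
    unfolding sgrp_epi_def sgrp_hom_def Reg_sgrp_def
    by (simp add: into hom mul_simps carr_PT_sgrp)
qed

text \<open>Here the inserted \<open>ab\<close> is absorbed by the second factor, as
  \<open>abk = k\<close>.\<close>

lemma theta2_epi:
  "(\<lambda>h. b \<Zsemi> h \<Zsemi> a) \<in> sgrp_epi (Reg_sgrp (PT_ker Y (pker a))) (PT_sgrp (ran a))"
proof -
  have into: "b \<Zsemi> h \<Zsemi> a \<in> PT (ran a) (ran a)" if "h \<in> Reg (PT_ker Y (pker a))" for h
    using that unfolding PT_ran_iff Reg_PT_ker_iff
    by (auto intro: PT_closed simp: aba_simps)
  have hom: "b \<Zsemi> (h \<Zsemi> k) \<Zsemi> a = (b \<Zsemi> h \<Zsemi> a) \<Zsemi> (b \<Zsemi> k \<Zsemi> a)"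
    if "k \<in> Reg (PT_ker Y (pker a))" for h k :: "'y \<rightharpoonup> 'y"
  proof -
    have abk: "a \<Zsemi> (b \<Zsemi> k) = k"
      using that unfolding Reg_PT_ker_iff by blast
    show ?thesis
      by (simp add: pcomp_assoc pcomp_extend[OF abk])
  qed
  have onto: "\<exists>h \<in> Reg (PT_ker Y (pker a)). f = b \<Zsemi> h \<Zsemi> a" if f: "f \<in> PT (ran a) (ran a)" for f
  proof -
    obtain m where m: "m \<in> PT (ran a) (ran a)" "f \<Zsemi> (m \<Zsemi> f) = f"
      using PT_von_neumann_regular[OF f] by blast
    \<comment> \<open>The target element is transported from \<open>ran a\<close> to
      \<open>Y\<close>: \<open>b(afb)a = (ba)f(ba) = f\<close>, and
      \<open>(afb)(amb)(afb) = a(fmf)b\<close>.\<close>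
    let ?h = "a \<Zsemi> (f \<Zsemi> b)" and ?u = "a \<Zsemi> (m \<Zsemi> b)"
    have f': "b \<Zsemi> (a \<Zsemi> f) = f" "f \<Zsemi> (b \<Zsemi> a) = f" and m': "m \<Zsemi> (b \<Zsemi> a) = m"
      using f m(1) unfolding PT_ran_iff by blast+
    have "?h \<Zsemi> (?u \<Zsemi> ?h) = ?h"
      by (simp add: pcomp_assoc pcomp_extend[OF f'(2)] pcomp_extend[OF m'] pcomp_extend[OF m(2)])
    moreover have "?h \<in> PT Y Y" "?u \<in> PT Y Y"
      using f m(1) by (auto intro: PT_closed)
    ultimately have "?h \<in> Reg (PT_ker Y (pker a))"
      by (intro Reg_PT_kerI[where u = ?u]) (simp_all add: aba_simps)
    moreover have "f = b \<Zsemi> ?h \<Zsemi> a"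
      by (simp add: pcomp_assoc pcomp_extend[OF f'(1)] f')
    ultimately show ?thesis by blast
  qed
  have "(\<lambda>h. b \<Zsemi> h \<Zsemi> a) ` Reg (PT_ker Y (pker a)) = PT (ran a) (ran a)"
    unfolding image_def using into onto by blast
  then show ?thesis
    unfolding sgrp_epi_def sgrp_hom_def Reg_sgrp_def
    by (simp add: into hom mul_simps carr_PT_sgrp)
qed

text \<open>Multiplying on the left by \<open>a\<close> uses \<open>aba = a\<close> and
  \<open>abh = h\<close>; multiplying by \<open>b\<close> goes back. So the fibre product has the
  image of \<open>psi\<close> as its carrier.\<close>

lemma theta_eq_iff:
  assumes "g \<in> Reg (PT_im X (ran a))" "h \<in> Reg (PT_ker Y (pker a))"
  shows "b \<Zsemi> a \<Zsemi> g = b \<Zsemi> h \<Zsemi> a \<longleftrightarrow> a \<Zsemi> g = h \<Zsemi> a"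
proof
  have h: "a \<Zsemi> (b \<Zsemi> h) = h"
    using assms(2) unfolding Reg_PT_ker_iff by blast
  assume "b \<Zsemi> a \<Zsemi> g = b \<Zsemi> h \<Zsemi> a"
  from arg_cong[OF this, of "\<lambda>z. a \<Zsemi> z"] show "a \<Zsemi> g = h \<Zsemi> a"
    by (simp add: aba_simps pcomp_extend[OF h])
qed (simp add: pcomp_assoc)

lemma pullback_via_psi:
  "pullback_via (Reg_sgrp (sandwich X Y a))
     (Reg_sgrp (PT_im X (ran a))) (Reg_sgrp (PT_ker Y (pker a))) (PT_sgrp (ran a))
     (\<lambda>g. b \<Zsemi> a \<Zsemi> g) (\<lambda>h. b \<Zsemi> h \<Zsemi> a) (psi a)"
proof -
  let ?F = "fibre_product (Reg_sgrp (PT_im X (ran a))) (Reg_sgrp (PT_ker Y (pker a)))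
              (\<lambda>g. b \<Zsemi> a \<Zsemi> g) (\<lambda>h. b \<Zsemi> h \<Zsemi> a)"
  have "carr ?F = psi a ` Reg (sandwich X Y a)"
    unfolding psi_image using theta_eq_iff by (auto simp: fibre_product_def Reg_sgrp_def)
  then have "psi a \<in> sgrp_iso (Reg_sgrp (sandwich X Y a)) ?F"
    using psi_inj
    by (auto simp: sgrp_iso_def sgrp_hom_def bij_betw_def Reg_sgrp_def)
       \<comment> \<open>Multiplicativity is associativity: \<open>(fag)a = (fa)(ga)\<close> and
         \<open>a(fag) = (af)(ag)\<close>.\<close>
       (auto simp: psi_def fibre_product_def sgrp_prod_def mul_simps pcomp_assoc)
  then show ?thesis
    unfolding pullback_via_def
    using is_semigroup_Reg is_semigroup_PT theta1_epi theta2_epi by blast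
qed

end

theorem theorem2p27:
  fixes X A :: "'x set" and Y :: "'y set" and a :: "'y \<rightharpoonup> 'x" and \<sigma> :: "'y rel"
  assumes "a \<in> PT Y X" and "A = ran a" and "\<sigma> = pker a"
  shows "psi a \<in> Reg (sandwich X Y a) \<rightarrow> Reg (PT_im X A) \<times> Reg (PT_ker Y \<sigma>) \<and>
         inj_on (psi a) (Reg (sandwich X Y a)) \<and>
         psi a ` Reg (sandwich X Y a) =
           {(g, h) \<in> Reg (PT_im X A) \<times> Reg (PT_ker Y \<sigma>). a \<Zsemi> g = h \<Zsemi> a} \<and>
         pullback_product (Reg_sgrp (sandwich X Y a))
           (Reg_sgrp (PT_im X A)) (Reg_sgrp (PT_ker Y \<sigma>)) (PT_sgrp A) \<and>
         (\<forall>b \<in> cross_sections Y a.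
           pullback_via (Reg_sgrp (sandwich X Y a))
             (Reg_sgrp (PT_im X A)) (Reg_sgrp (PT_ker Y \<sigma>)) (PT_sgrp A)
             (\<lambda>g. b \<Zsemi> a \<Zsemi> g) (\<lambda>h. b \<Zsemi> h \<Zsemi> a) (psi a))"
proof -
  have sect: "sandwich_section X Y a b" if "b \<in> cross_sections Y a" for b
    using assms(1) that by (rule sandwich_section.intro)
  obtain b where "b \<in> cross_sections Y a"
    using cross_sections_nonempty[OF assms(1)] by blast
  then interpret sandwich_section X Y a b
    by (rule sect)
  have "psi a \<in> Reg (sandwich X Y a) \<rightarrow> Reg (PT_im X A) \<times> Reg (PT_ker Y \<sigma>)"
    unfolding assms(2,3) using psi_in_Reg by (auto simp: psi_def)
  moreover have "pullback_product (Reg_sgrp (sandwich X Y a))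
      (Reg_sgrp (PT_im X A)) (Reg_sgrp (PT_ker Y \<sigma>)) (PT_sgrp A)"
    unfolding assms(2,3) pullback_product_def using pullback_via_psi by blast
  ultimately show ?thesis
    \<comment> \<open>The last conjunct ranges over all cross sections, so it uses the locale at an
      arbitrary one instead of the fixed \<open>b\<close>.\<close>
    using psi_inj psi_image sandwich_section.pullback_via_psi[OF sect]
    unfolding assms(2,3) by blast
qed

end
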